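(* Let $\mathcal S$ be a target index set with corresponding data set $\mathcal D_s$, and let $\bm y_i=(\mathbb I\{y_i=j\})_{j\in\{0\}\cup\mathcal J}$. (i) Superset inheritance. If $\mathcal E\subseteq\mathcal S$ has a dual-feasible pair $(\bm q^{\mathcal E},\bm\mu^{\mathcal E})$ (dual feasible on $\mathcal E$), set $\widetilde{\bm q}_i=\bm q_i^{\mathcal E}$ for $i\in\mathcal E$ and $\widetilde{\bm q}_i=\bm y_i$ for $i\in\mathcal S\setminus\mathcal E$. Then $(\widetilde{\bm q},\bm\mu^{\mathcal E})$ is dual feasible on $\mathcal S$ and $$\mathcal B_{\mathcal S}(\widetilde{\bm q},\bm\mu^{\mathcal E})=\mathcal B_{\mathcal E}(\bm q^{\mathcal E},\bm\mu^{\mathcal E}).$$ Hence $H(\mathcal D_s)\ge\lambda N_0+\mathcal B_{\mathcal E}(\bm q^{\mathcal E},\bm\mu^{\mathcal E})$. (ii) Disjoint-set aggregation. More generally, let $\mathcal G$ be a collection of pairwise disjoint subsets of $\mathcal S$, each $\mathcal E\in\mathcal G$ with a dual-feasible pair $(\bm q^{\mathcal E},\bm\mu^{\mathcal E})$ on $\mathcal E$. Set $\widetilde{\bm q}_i=\bm q_i^{\mathcal E}$ for $i\in\mathcal E\in\mathcal G$, $\widetilde{\bm q}_i=\bm y_i$ for observations $i\in\mathcal S$ not covered by $\mathcal G$, and $\widetilde{\bm\mu}=\sum_{\mathcal E\in\mathcal G}\bm\mu^{\mathcal E}$. Then $(\widetilde{\bm q},\widetilde{\bm\mu})$ is dual feasible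 on $\mathcal S$ and $$\mathcal B_{\mathcal S}(\widetilde{\bm q},\widetilde{\bm\mu})=\sum_{\mathcal E\in\mathcal G}\mathcal B_{\mathcal E}(\bm q^{\mathcal E},\bm\mu^{\mathcal E}).$$ Consequently, $H(\mathcal D_s)\ge\lambda N_0+\sum_{\mathcal E\in\mathcal G}\mathcal B_{\mathcal E}(\bm q^{\mathcal E},\bm\mu^{\mathcal E})$.
   Context: $\mathcal J$ is a finite nonempty set of products, $0$ is the outside option, $\mathcal F$ is a finite set of covariates. Data: $\mathcal D=\{(\bm x_i,\bm p_i,y_i)\}_{i\in\mathcal I}$, $\mathcal I$ finite, $\bm x_i\in\mathbb R^{|\mathcal F|}$, $\bm p_i\in\mathbb R_+^{|\mathcal J|}$, $y_i\in\{0\}\cup\mathcal J$. All index sets are subsets of $\mathcal I$. Parameters $\bm\theta=(\bm\alpha,\bm\beta,\bm\gamma)\in\mathbb R^{N_0}$, $N_0=2|\mathcal J|+|\mathcal F|$. With $\bm e_j$ the $j$th coordinate vector of $\mathbb R^{|\mathcal J|}$, $\bm a_{ij}=(\bm e_j,\bm x_i,-p_{ij}\bm e_j)\in\mathbb R^{N_0}$ for $j\in\mathcal J$ and $\bm a_{i0}=\bm0$. $\pi_{ij}(\bm\theta)=\exp(\bm a_{ij}^\top\bm\theta)/\sum_{l\in\{0\}\cup\mathcal J}\exp(\bm a_{il}^\top\bm\theta)$, $\ell_i(\bm\theta)=-\log\pi_{i,y_i}(\bm\theta)$. $\Theta=\{\bm\theta\in\mathbb R^{N_0}:\bm A_\Theta\bm\theta\le\bm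 b_\Theta\}$ is a nonempty closed polyhedron (whose constraints include $\gamma_j\ge\underline\gamma>0$). With penalty $\lambda\ge0$ and minimum leaf size $N_{\min}\ge1$, the leaf cost is $H(\mathcal D_s)=\min_{\bm\theta\in\Theta}\{\sum_{i\in\mathcal S}\ell_i(\bm\theta)+\lambda N_0\}$ if $|\mathcal D_s|\ge N_{\min}$ and $+\infty$ otherwise; every finite leaf problem is assumed to attain its minimum. $\Delta_{\mathcal J}$ is the probability simplex over $\{0\}\cup\mathcal J$. For an index set $\mathcal S$ and $\bm q=(\bm q_i)_{i\in\mathcal S}$, $\bm q_i\in\Delta_{\mathcal J}$: $r_{\mathcal S}(\bm q)=\sum_{i\in\mathcal S}\sum_{j\in\{0\}\cup\mathcal J}(q_{ij}-\mathbb I\{y_i=j\})\bm a_{ij}$ and $\mathcal H_{\mathcal S}(\bm q)=-\sum_{i\in\mathcal S}\sum_{j\in\{0\}\cup\mathcal J}q_{ij}\log q_{ij}$ (with $0\log0=0$). The pair $(\bm q,\bm\mu)$ is dual feasible on $\mathcal S$ if $\bm q_i\in\Delta_{\mathcal J}$ for all $i\in\mathcal S$, $\bm\mu\ge\bm0$, and $r_{\mathcal S}(\bm q)+\bm A_\Theta^\top\bm\mu=\bm0$. Its dual value is $\mathcal B_{\mathcal S}(\bm q,\bm\mu)=\mathcal H_{\mathcal S}(\bm q)-\bm b_\Theta^\top\bm\mu$. *)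

theory Defs
  imports Complex_Main "HOL-Library.Extended_Real" "HOL-Library.FuncSet" "HOL-Library.Disjoint_Sets"
begin

datatype ('j, 'f) coord = Alpha 'j | Beta 'f | Gamma 'j

text \<open>
  All finite index sets are explicit carriers, so that the set of covariates may be empty.
  Alternatives are of type \<open>'j option\<close>, where \<open>None\<close> is the outside option. Functions are
  only ever evaluated on the carriers. The rows of the linear system defining the feasible
  polyhedron are indexed by \<open>rows\<close>.
\<close>

record ('i, 'j, 'f, 'k) leaf_data =
  products :: "'j set"
  covariates :: "'f set"
  observations :: "'i set"
  covar :: "'i \<Rightarrow> 'f \<Rightarrow> real"
  price :: "'i \<Rightarrow> 'j \<Rightarrow> real"
  choice :: "'i \<Rightarrow> 'j option"
  rows :: "'k set"
  con_mat :: "'k \<Rightarrow> ('j, 'f) coord \<Rightarrow> real"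
  con_rhs :: "'k \<Rightarrow> real"
  penalty :: real
  min_leaf :: nat

definition alternatives :: "('i, 'j, 'f, 'k) leaf_data \<Rightarrow> 'j option set" where
  "alternatives M = insert None (Some ` products M)"

definition coords :: "('i, 'j, 'f, 'k) leaf_data \<Rightarrow> ('j, 'f) coord set" where
  "coords M = Alpha ` products M \<union> Beta ` covariates M \<union> Gamma ` products M"

definition num_params :: "('i, 'j, 'f, 'k) leaf_data \<Rightarrow> nat" where
  "num_params M = 2 * card (products M) + card (covariates M)"

lemma card_coords:
  fixes M :: "('i, 'j, 'f, 'k) leaf_data"
  assumes "finite (products M)" "finite (covariates M)"
  shows "card (coords M) = num_params M"
proof -
  have "card (coords M)
      = card (Alpha ` products M \<union> Beta ` covariates M :: ('j, 'f) coord set)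
        + card (Gamma ` products M :: ('j, 'f) coord set)"
    unfolding coords_def using assms by (intro card_Un_disjoint) auto
  also have "card (Alpha ` products M \<union> Beta ` covariates M :: ('j, 'f) coord set)
      = card (Alpha ` products M :: ('j, 'f) coord set)
        + card (Beta ` covariates M :: ('j, 'f) coord set)"
    using assms by (intro card_Un_disjoint) auto
  finally show ?thesis
    by (simp add: card_image inj_on_def num_params_def)
qed

definition inner_on :: "'c set \<Rightarrow> ('c \<Rightarrow> real) \<Rightarrow> ('c \<Rightarrow> real) \<Rightarrow> real" where
  "inner_on C u v = (\<Sum>c\<in>C. u c * v c)"

fun attr :: "('i, 'j, 'f, 'k) leaf_data \<Rightarrow> 'i \<Rightarrow> 'j option \<Rightarrow> ('j, 'f) coord \<Rightarrow> real" where
  "attr M i None c = 0"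
| "attr M i (Some j) (Alpha k) = (if k = j then 1 else 0)"
| "attr M i (Some j) (Beta f) = covar M i f"
| "attr M i (Some j) (Gamma k) = (if k = j then - price M i j else 0)"

definition choice_prob ::
    "('i, 'j, 'f, 'k) leaf_data \<Rightarrow> (('j, 'f) coord \<Rightarrow> real) \<Rightarrow> 'i \<Rightarrow> 'j option \<Rightarrow> real" where
  "choice_prob M \<theta> i j =
     exp (inner_on (coords M) (attr M i j) \<theta>) /
     (\<Sum>l\<in>alternatives M. exp (inner_on (coords M) (attr M i l) \<theta>))"

definition neg_loglik ::
    "('i, 'j, 'f, 'k) leaf_data \<Rightarrow> 'i \<Rightarrow> (('j, 'f) coord \<Rightarrow> real) \<Rightarrow> real" where
  "neg_loglik M i \<theta> = - ln (choice_prob M \<theta> i (choice M i))"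

definition Theta :: "('i, 'j, 'f, 'k) leaf_data \<Rightarrow> (('j, 'f) coord \<Rightarrow> real) set" where
  "Theta M = {\<theta> \<in> coords M \<rightarrow>\<^sub>E UNIV.
     \<forall>k\<in>rows M. inner_on (coords M) (con_mat M k) \<theta> \<le> con_rhs M k}"

definition leaf_objective ::
    "('i, 'j, 'f, 'k) leaf_data \<Rightarrow> 'i set \<Rightarrow> (('j, 'f) coord \<Rightarrow> real) \<Rightarrow> real" where
  "leaf_objective M S \<theta> = (\<Sum>i\<in>S. neg_loglik M i \<theta>) + penalty M * real (num_params M)"

text \<open>
  A leaf data set is identified with its index set, so its size is the number of indices
  (observations with equal data are counted separately). The \<open>LEAST\<close> below is the minimum
  of the objective over the feasible set; its existence is an assumption of the locale
  \<open>leaf_model\<close>.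
\<close>

definition leaf_cost :: "('i, 'j, 'f, 'k) leaf_data \<Rightarrow> 'i set \<Rightarrow> ereal" where
  "leaf_cost M S =
     (if min_leaf M \<le> card S then ereal (LEAST v. v \<in> leaf_objective M S ` Theta M) else \<infinity>)"

locale leaf_model =
  fixes M :: "('i, 'j, 'f, 'k) leaf_data"
  assumes finite_products: "finite (products M)"
    and products_nonempty: "products M \<noteq> {}"
    and finite_covariates: "finite (covariates M)"
    and finite_observations: "finite (observations M)"
    and finite_rows: "finite (rows M)"
    and price_nonneg: "\<And>i j. i \<in> observations M \<Longrightarrow> j \<in> products M \<Longrightarrow> 0 \<le> price M i j"
    and choice_alternatives: "\<And>i. i \<in> observations M \<Longrightarrow> choice M i \<in> alternatives M"
    and Theta_nonempty: "Theta M \<noteq> {}"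
    and Theta_gamma: "\<exists>g>0. \<forall>\<theta>\<in>Theta M. \<forall>j\<in>products M. g \<le> \<theta> (Gamma j)"
    and penalty_nonneg: "0 \<le> penalty M"
    and min_leaf_pos: "1 \<le> min_leaf M"
    and minimum_attained: "\<And>T. T \<subseteq> observations M \<Longrightarrow> min_leaf M \<le> card T \<Longrightarrow>
      \<exists>\<theta>\<in>Theta M. \<forall>\<theta>'\<in>Theta M. leaf_objective M T \<theta> \<le> leaf_objective M T \<theta>'"

definition simplex :: "('i, 'j, 'f, 'k) leaf_data \<Rightarrow> ('j option \<Rightarrow> real) set" where
  "simplex M = {v. (\<forall>j\<in>alternatives M. 0 \<le> v j) \<and> (\<Sum>j\<in>alternatives M. v j) = 1}"

definition choice_ind :: "('i, 'j, 'f, 'k) leaf_data \<Rightarrow> 'i \<Rightarrow> 'j option \<Rightarrow> real" where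
  "choice_ind M i j = (if choice M i = j then 1 else 0)"

definition residual ::
    "('i, 'j, 'f, 'k) leaf_data \<Rightarrow> 'i set \<Rightarrow> ('i \<Rightarrow> 'j option \<Rightarrow> real) \<Rightarrow> ('j, 'f) coord \<Rightarrow> real" where
  "residual M S q c = (\<Sum>i\<in>S. \<Sum>j\<in>alternatives M. (q i j - choice_ind M i j) * attr M i j c)"

text \<open>The convention \<open>0 log 0 = 0\<close> holds automatically, since \<open>0 * ln 0 = 0\<close> here.\<close>

definition entropy ::
    "('i, 'j, 'f, 'k) leaf_data \<Rightarrow> 'i set \<Rightarrow> ('i \<Rightarrow> 'j option \<Rightarrow> real) \<Rightarrow> real" where
  "entropy M S q = - (\<Sum>i\<in>S. \<Sum>j\<in>alternatives M. q i j * ln (q i j))"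

definition dual_feasible ::
    "('i, 'j, 'f, 'k) leaf_data \<Rightarrow> 'i set \<Rightarrow> ('i \<Rightarrow> 'j option \<Rightarrow> real) \<Rightarrow> ('k \<Rightarrow> real) \<Rightarrow> bool" where
  "dual_feasible M S q \<mu> \<longleftrightarrow>
     (\<forall>i\<in>S. q i \<in> simplex M) \<and>
     (\<forall>k\<in>rows M. 0 \<le> \<mu> k) \<and>
     (\<forall>c\<in>coords M. residual M S q c + (\<Sum>k\<in>rows M. con_mat M k c * \<mu> k) = 0)"

definition dual_value ::
    "('i, 'j, 'f, 'k) leaf_data \<Rightarrow> 'i set \<Rightarrow> ('i \<Rightarrow> 'j option \<Rightarrow> real) \<Rightarrow> ('k \<Rightarrow> real) \<Rightarrow> real" where
  "dual_value M S q \<mu> = entropy M S q - inner_on (rows M) (con_rhs M) \<mu>"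

definition inherit_q ::
    "('i, 'j, 'f, 'k) leaf_data \<Rightarrow> 'i set \<Rightarrow> ('i \<Rightarrow> 'j option \<Rightarrow> real) \<Rightarrow> 'i \<Rightarrow> 'j option \<Rightarrow> real" where
  "inherit_q M E q i = (if i \<in> E then q i else choice_ind M i)"

text \<open>For a disjoint collection, the block containing a covered index is unique.\<close>

definition aggregate_q ::
    "('i, 'j, 'f, 'k) leaf_data \<Rightarrow> 'i set set \<Rightarrow> ('i set \<Rightarrow> 'i \<Rightarrow> 'j option \<Rightarrow> real) \<Rightarrow>
     'i \<Rightarrow> 'j option \<Rightarrow> real" where
  "aggregate_q M G q i =
     (if i \<in> \<Union>G then q (THE E. E \<in> G \<and> i \<in> E) i else choice_ind M i)"

end

theory Submission
  imports Defs
begin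

text \<open>
  Two ideas carry the proof.

  The first is that an observed choice is a free dual vector: if \<open>q i\<close> is the indicator of the
  alternative chosen by observation \<open>i\<close>, then \<open>i\<close> adds nothing to the residual, because
  \<open>q i\<close> and the indicator cancel, and nothing to the entropy, because the indicator is
  degenerate. Residual and entropy are sums over observations, so over a disjoint collection
  extended by indicators they split into the sums over the members
  (\<open>sum_aggregate_q\<close>). The multipliers enter the constraint and the dual value linearly, hence
  adding the dual pairs of disjoint blocks preserves feasibility and adds the values
  (\<open>dual_feasible_aggregate\<close>, \<open>dual_value_aggregate\<close>). Superset inheritance is the case
  of a single block.

  The second is weak duality (\<open>weak_duality\<close>). By Gibbs' inequality a log-sum-exp dominates
  expected utility plus entropy for every choice distribution \<open>q\<close>. Applied to
  each observation, it bounds the negative log-likelihood at \<open>\<theta>\<close> from below by the entropy of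
  \<open>q\<close> plus the inner product of the residual with \<open>\<theta>\<close>. Dual feasibility turns that
  inner product into minus the multipliers paired with the left-hand sides of the constraints at
  \<open>\<theta>\<close>, which feasibility of \<open>\<theta>\<close> bounds by the right-hand sides.
\<close>

section \<open>Weak duality\<close>

text \<open>
  Relative entropy of \<open>q\<close> with respect to the softmax distribution \<open>p\<close> is nonnegative:
  \<open>ln t \<le> t - 1\<close> at \<open>t = p l / q l\<close> gives \<open>q l * ln (p l / q l) \<le> p l - q l\<close>,
  and both distributions have total mass one.
\<close>

lemma log_sum_exp_ge_entropy:
  fixes q u :: "'a \<Rightarrow> real"
  assumes fin: "finite A" and q: "\<And>l. l \<in> A \<Longrightarrow> 0 \<le> q l" and q1: "(\<Sum>l\<in>A. q l) = 1"
  shows "(\<Sum>l\<in>A. q l * u l) - (\<Sum>l\<in>A. q l * ln (q l)) \<le> ln (\<Sum>l\<in>A. exp (u l))"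
proof -
  define Z where "Z = (\<Sum>l\<in>A. exp (u l))"
  have "A \<noteq> {}"
    using q1 by auto
  then have Z: "0 < Z"
    unfolding Z_def using fin by (intro sum_pos) auto
  have pointwise: "q l * (u l - ln Z - ln (q l)) \<le> exp (u l) / Z - q l" if l: "l \<in> A" for l
  proof (cases "q l = 0")
    case True
    then show ?thesis using Z by simp
  next
    case False
    with q[OF l] have ql: "0 < q l" by simp
    have "u l - ln Z - ln (q l) = ln (exp (u l) / (Z * q l))"
      using Z ql by (simp add: ln_div ln_mult)
    also have "\<dots> \<le> exp (u l) / (Z * q l) - 1"
      using Z ql by (intro ln_le_minus_one) simp
    finally have "q l * (u l - ln Z - ln (q l)) \<le> q l * (exp (u l) / (Z * q l) - 1)"
      using ql by (intro mult_left_mono) auto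
    also have "\<dots> = exp (u l) / Z - q l"
      using ql Z by (simp add: field_simps)
    finally show ?thesis .
  qed
  have "(\<Sum>l\<in>A. q l * u l) - (\<Sum>l\<in>A. q l * ln (q l)) - ln Z
      = (\<Sum>l\<in>A. q l * u l) - (\<Sum>l\<in>A. q l * ln (q l)) - (\<Sum>l\<in>A. q l) * ln Z"
    by (simp add: q1)
  also have "\<dots> = (\<Sum>l\<in>A. q l * (u l - ln Z - ln (q l)))"
    by (simp add: right_diff_distrib sum_subtractf sum_distrib_right)
  also have "\<dots> \<le> (\<Sum>l\<in>A. exp (u l) / Z - q l)"
    by (intro sum_mono pointwise)
  also have "\<dots> = (\<Sum>l\<in>A. exp (u l)) / Z - (\<Sum>l\<in>A. q l)"
    by (simp add: sum_subtractf sum_divide_distrib)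
  also have "\<dots> = 0"
    using Z q1 by (simp add: Z_def)
  finally show ?thesis
    by (simp add: Z_def)
qed

lemma finite_alternatives: "leaf_model M \<Longrightarrow> finite (alternatives M)"
  by (simp add: alternatives_def leaf_model.finite_products)

lemma neg_loglik_eq_log_sum_exp:
  assumes "leaf_model M"
  shows "neg_loglik M i \<theta>
    = ln (\<Sum>l\<in>alternatives M. exp (inner_on (coords M) (attr M i l) \<theta>))
      - inner_on (coords M) (attr M i (choice M i)) \<theta>"
proof -
  have "0 < (\<Sum>l\<in>alternatives M. exp (inner_on (coords M) (attr M i l) \<theta>))"
    using finite_alternatives[OF assms] by (intro sum_pos) (auto simp: alternatives_def)
  then show ?thesis
    unfolding neg_loglik_def choice_prob_def by (simp add: ln_div)
qed

lemma inner_on_residual: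
  "inner_on (coords M) (residual M S q) \<theta>
    = (\<Sum>i\<in>S. \<Sum>j\<in>alternatives M.
        (q i j - choice_ind M i j) * inner_on (coords M) (attr M i j) \<theta>)"
proof -
  have "inner_on (coords M) (residual M S q) \<theta>
      = (\<Sum>c\<in>coords M. \<Sum>i\<in>S. \<Sum>j\<in>alternatives M.
          (q i j - choice_ind M i j) * (attr M i j c * \<theta> c))"
    by (simp add: inner_on_def residual_def sum_distrib_right mult.assoc)
  also have "\<dots> = (\<Sum>i\<in>S. \<Sum>c\<in>coords M. \<Sum>j\<in>alternatives M.
          (q i j - choice_ind M i j) * (attr M i j c * \<theta> c))"
    by (rule sum.swap)
  also have "\<dots> = (\<Sum>i\<in>S. \<Sum>j\<in>alternatives M. \<Sum>c\<in>coords M.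
          (q i j - choice_ind M i j) * (attr M i j c * \<theta> c))"
    by (intro sum.cong refl sum.swap)
  finally show ?thesis
    by (simp add: inner_on_def sum_distrib_left)
qed

lemma sum_choice_ind:
  assumes "leaf_model M" "i \<in> observations M"
  shows "(\<Sum>j\<in>alternatives M. choice_ind M i j * f j) = f (choice M i)"
  using finite_alternatives[OF assms(1)] leaf_model.choice_alternatives[OF assms]
  by (simp add: choice_ind_def sum.delta' if_distrib[of "\<lambda>x. x * _"] cong: if_cong)

text \<open>
  The observed utility enters the negative log-likelihood with a minus sign, exactly as the
  choice indicator enters the residual, so the per-observation Gibbs bounds add up to entropy
  plus residual. Stationarity then trades the parameter \<open>\<theta>\<close> for the constraint rows.
\<close>

lemma weak_duality:
  assumes M: "leaf_model M" and S: "S \<subseteq> observations M"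
    and \<theta>: "\<theta> \<in> Theta M" and dual: "dual_feasible M S q \<mu>"
  shows "dual_value M S q \<mu> \<le> (\<Sum>i\<in>S. neg_loglik M i \<theta>)"
proof -
  let ?A = "alternatives M"
  define u where "u i j = inner_on (coords M) (attr M i j) \<theta>" for i j
  have stationary: "residual M S q c = - (\<Sum>k\<in>rows M. con_mat M k c * \<mu> k)"
    if "c \<in> coords M" for c
    using dual that unfolding dual_feasible_def by (simp add: eq_neg_iff_add_eq_0)
  have "inner_on (coords M) (residual M S q) \<theta>
      = - (\<Sum>c\<in>coords M. \<Sum>k\<in>rows M. \<mu> k * (con_mat M k c * \<theta> c))"
    by (simp add: inner_on_def stationary sum_distrib_left sum_negf ac_simps)
  also have "\<dots> = - (\<Sum>k\<in>rows M. \<mu> k * inner_on (coords M) (con_mat M k) \<theta>)"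
    by (subst sum.swap) (simp add: inner_on_def sum_distrib_left)
  finally have residual_eq: "inner_on (coords M) (residual M S q) \<theta>
      = - (\<Sum>k\<in>rows M. \<mu> k * inner_on (coords M) (con_mat M k) \<theta>)" .
  have "(\<Sum>k\<in>rows M. \<mu> k * inner_on (coords M) (con_mat M k) \<theta>)
      \<le> (\<Sum>k\<in>rows M. \<mu> k * con_rhs M k)"
    using \<theta> dual by (intro sum_mono mult_left_mono) (auto simp: Theta_def dual_feasible_def)
  then have "dual_value M S q \<mu> \<le> entropy M S q + inner_on (coords M) (residual M S q) \<theta>"
    unfolding dual_value_def residual_eq by (simp add: inner_on_def mult.commute)
  also have "\<dots> = (\<Sum>i\<in>S. (\<Sum>j\<in>?A. (q i j - choice_ind M i j) * u i j)
      - (\<Sum>j\<in>?A. q i j * ln (q i j)))"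
    by (simp add: inner_on_residual entropy_def sum_subtractf u_def)
  also have "\<dots> \<le> (\<Sum>i\<in>S. neg_loglik M i \<theta>)"
  proof (intro sum_mono)
    fix i assume i: "i \<in> S"
    with dual have "q i \<in> simplex M"
      unfolding dual_feasible_def by blast
    then have "(\<Sum>j\<in>?A. q i j * u i j) - (\<Sum>j\<in>?A. q i j * ln (q i j))
        \<le> ln (\<Sum>j\<in>?A. exp (u i j))"
      using finite_alternatives[OF M] by (intro log_sum_exp_ge_entropy) (auto simp: simplex_def)
    moreover have "(\<Sum>j\<in>?A. (q i j - choice_ind M i j) * u i j)
        = (\<Sum>j\<in>?A. q i j * u i j) - u i (choice M i)"
      using sum_choice_ind[OF M, of i "u i"] S i
      by (auto simp: left_diff_distrib sum_subtractf)
    ultimately show "(\<Sum>j\<in>?A. (q i j - choice_ind M i j) * u i j)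
        - (\<Sum>j\<in>?A. q i j * ln (q i j)) \<le> neg_loglik M i \<theta>"
      using neg_loglik_eq_log_sum_exp[OF M, of i \<theta>] by (simp add: u_def)
  qed
  finally show ?thesis .
qed

lemma leaf_cost_ge_dual_value:
  assumes M: "leaf_model M" and S: "S \<subseteq> observations M" and dual: "dual_feasible M S q \<mu>"
  shows "ereal (penalty M * real (num_params M) + dual_value M S q \<mu>) \<le> leaf_cost M S"
proof (cases "min_leaf M \<le> card S")
  case True
  then obtain \<theta> where \<theta>: "\<theta> \<in> Theta M"
    and minimal: "\<And>\<theta>'. \<theta>' \<in> Theta M \<Longrightarrow> leaf_objective M S \<theta> \<le> leaf_objective M S \<theta>'"
    using leaf_model.minimum_attained[OF M S] by blast
  \<comment> \<open>\<open>LEAST\<close> on the reals has a meaning only through an attained minimum.\<close>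
  have "(LEAST v. v \<in> leaf_objective M S ` Theta M) = leaf_objective M S \<theta>"
    using \<theta> minimal by (intro Least_equality) auto
  then show ?thesis
    using True weak_duality[OF M S \<theta> dual] by (simp add: leaf_cost_def leaf_objective_def)
qed (simp add: leaf_cost_def)

section \<open>Aggregating dual pairs of disjoint blocks\<close>

lemma aggregate_q_block:
  assumes "disjoint G" "E \<in> G" "i \<in> E"
  shows "aggregate_q M G q i = q E i"
proof -
  have "(THE E. E \<in> G \<and> i \<in> E) = E"
    using assms by (intro the_equality) (auto dest: disjointD)
  then show ?thesis
    using assms by (auto simp: aggregate_q_def)
qed

lemma aggregate_q_singleton: "aggregate_q M {E} (\<lambda>_. q) = inherit_q M E q"
  by (rule ext) (simp add: aggregate_q_def inherit_q_def)

text \<open>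
  The common form of the residual and the entropy: a sum over observations whose summand
  vanishes at the observed choice only sees the blocks.
\<close>

lemma sum_aggregate_q:
  fixes h :: "'i \<Rightarrow> ('j option \<Rightarrow> real) \<Rightarrow> real"
  assumes S: "finite S" and G: "\<And>E. E \<in> G \<Longrightarrow> E \<subseteq> S" and disj: "disjoint G"
    and h: "\<And>i. i \<in> S \<Longrightarrow> h i (choice_ind M i) = 0"
  shows "(\<Sum>i\<in>S. h i (aggregate_q M G q i)) = (\<Sum>E\<in>G. \<Sum>i\<in>E. h i (q E i))"
proof -
  have "(\<Sum>i\<in>S. h i (aggregate_q M G q i)) = (\<Sum>i\<in>\<Union>G. h i (aggregate_q M G q i))"
    using S G h by (intro sum.mono_neutral_right) (auto simp: aggregate_q_def)
  also have "\<dots> = (\<Sum>E\<in>G. \<Sum>i\<in>E. h i (aggregate_q M G q i))"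
    using S G disj
    by (subst sum.Union_disjoint) (auto intro: finite_subset dest: disjointD)
  also have "\<dots> = (\<Sum>E\<in>G. \<Sum>i\<in>E. h i (q E i))"
    using disj by (intro sum.cong refl) (simp add: aggregate_q_block)
  finally show ?thesis .
qed

lemma residual_aggregate:
  assumes "finite S" "\<And>E. E \<in> G \<Longrightarrow> E \<subseteq> S" "disjoint G"
  shows "residual M S (aggregate_q M G q) c = (\<Sum>E\<in>G. residual M E (q E) c)"
  unfolding residual_def
  by (rule sum_aggregate_q[OF assms,
        where h = "\<lambda>i v. \<Sum>j\<in>alternatives M. (v j - choice_ind M i j) * attr M i j c"]) auto

lemma entropy_aggregate:
  assumes "finite S" "\<And>E. E \<in> G \<Longrightarrow> E \<subseteq> S" "disjoint G"
  shows "entropy M S (aggregate_q M G q) = (\<Sum>E\<in>G. entropy M E (q E))"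
proof -
  have "(\<Sum>i\<in>S. \<Sum>j\<in>alternatives M. aggregate_q M G q i j * ln (aggregate_q M G q i j))
      = (\<Sum>E\<in>G. \<Sum>i\<in>E. \<Sum>j\<in>alternatives M. q E i j * ln (q E i j))"
    by (rule sum_aggregate_q[OF assms, where h = "\<lambda>i v. \<Sum>j\<in>alternatives M. v j * ln (v j)"])
      (auto simp: choice_ind_def intro!: sum.neutral)
  then show ?thesis
    by (simp add: entropy_def sum_negf)
qed

lemma dual_feasible_aggregate:
  assumes M: "leaf_model M" and S: "S \<subseteq> observations M"
    and G: "\<And>E. E \<in> G \<Longrightarrow> E \<subseteq> S" and disj: "disjoint G"
    and dual: "\<And>E. E \<in> G \<Longrightarrow> dual_feasible M E (q E) (\<mu> E)"
  shows "dual_feasible M S (aggregate_q M G q) (\<lambda>k. \<Sum>E\<in>G. \<mu> E k)"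
  unfolding dual_feasible_def
proof (intro conjI ballI)
  fix i assume i: "i \<in> S"
  show "aggregate_q M G q i \<in> simplex M"
  proof (cases "i \<in> \<Union>G")
    case True
    then obtain E where "E \<in> G" "i \<in> E" by blast
    then show ?thesis
      using dual[of E] aggregate_q_block[OF disj, of E i M q] by (simp add: dual_feasible_def)
  next
    case False
    then have "aggregate_q M G q i = choice_ind M i"
      by (simp add: aggregate_q_def)
    moreover have "(\<Sum>j\<in>alternatives M. choice_ind M i j) = 1"
      using sum_choice_ind[OF M, of i "\<lambda>_. 1"] S i by auto
    ultimately show ?thesis
      by (simp add: simplex_def choice_ind_def)
  qed
next
  fix k assume "k \<in> rows M"
  then show "0 \<le> (\<Sum>E\<in>G. \<mu> E k)"
    using dual by (intro sum_nonneg) (auto simp: dual_feasible_def)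
next
  fix c assume c: "c \<in> coords M"
  have "finite S"
    using S leaf_model.finite_observations[OF M] by (rule finite_subset)
  then have "residual M S (aggregate_q M G q) c = (\<Sum>E\<in>G. residual M E (q E) c)"
    using G disj by (rule residual_aggregate)
  moreover have "(\<Sum>k\<in>rows M. con_mat M k c * (\<Sum>E\<in>G. \<mu> E k))
      = (\<Sum>E\<in>G. \<Sum>k\<in>rows M. con_mat M k c * \<mu> E k)"
    unfolding sum_distrib_left by (rule sum.swap)
  ultimately have "residual M S (aggregate_q M G q) c
      + (\<Sum>k\<in>rows M. con_mat M k c * (\<Sum>E\<in>G. \<mu> E k))
      = (\<Sum>E\<in>G. residual M E (q E) c + (\<Sum>k\<in>rows M. con_mat M k c * \<mu> E k))"
    by (simp add: sum.distrib)
  also have "\<dots> = 0"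
    using dual c by (intro sum.neutral) (auto simp: dual_feasible_def)
  finally show "residual M S (aggregate_q M G q) c
      + (\<Sum>k\<in>rows M. con_mat M k c * (\<Sum>E\<in>G. \<mu> E k)) = 0" .
qed

lemma dual_value_aggregate:
  assumes "finite S" "\<And>E. E \<in> G \<Longrightarrow> E \<subseteq> S" "disjoint G"
  shows "dual_value M S (aggregate_q M G q) (\<lambda>k. \<Sum>E\<in>G. \<mu> E k)
    = (\<Sum>E\<in>G. dual_value M E (q E) (\<mu> E))"
proof -
  have "inner_on (rows M) (con_rhs M) (\<lambda>k. \<Sum>E\<in>G. \<mu> E k)
      = (\<Sum>E\<in>G. inner_on (rows M) (con_rhs M) (\<mu> E))"
    unfolding inner_on_def sum_distrib_left by (rule sum.swap)
  then show ?thesis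
    using entropy_aggregate[OF assms] by (simp add: dual_value_def sum_subtractf)
qed

theorem proposition3:
  fixes M :: "('i, 'j, 'f, 'k) leaf_data" and S :: "'i set"
  assumes "leaf_model M"
    and "S \<subseteq> observations M"
  shows
    "(\<forall>E q \<mu>. E \<subseteq> S \<and> dual_feasible M E q \<mu> \<longrightarrow>
        dual_feasible M S (inherit_q M E q) \<mu> \<and>
        dual_value M S (inherit_q M E q) \<mu> = dual_value M E q \<mu> \<and>
        leaf_cost M S \<ge> ereal (penalty M * real (num_params M) + dual_value M E q \<mu>)) \<and>
     (\<forall>G q \<mu>. (\<forall>E\<in>G. E \<subseteq> S) \<and> disjoint G \<and> (\<forall>E\<in>G. dual_feasible M E (q E) (\<mu> E)) \<longrightarrow>
        dual_feasible M S (aggregate_q M G q) (\<lambda>k. \<Sum>E\<in>G. \<mu> E k) \<and>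
        dual_value M S (aggregate_q M G q) (\<lambda>k. \<Sum>E\<in>G. \<mu> E k)
          = (\<Sum>E\<in>G. dual_value M E (q E) (\<mu> E)) \<and>
        leaf_cost M S \<ge>
          ereal (penalty M * real (num_params M) + (\<Sum>E\<in>G. dual_value M E (q E) (\<mu> E))))"
proof -
  note M = assms(1) and S = assms(2)
  have finS: "finite S"
    using S leaf_model.finite_observations[OF M] by (rule finite_subset)
  have aggregation: "dual_feasible M S (aggregate_q M G q) (\<lambda>k. \<Sum>E\<in>G. \<mu> E k) \<and>
      dual_value M S (aggregate_q M G q) (\<lambda>k. \<Sum>E\<in>G. \<mu> E k)
        = (\<Sum>E\<in>G. dual_value M E (q E) (\<mu> E)) \<and>
      leaf_cost M S \<ge>
        ereal (penalty M * real (num_params M) + (\<Sum>E\<in>G. dual_value M E (q E) (\<mu> E)))"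
    if G: "\<And>E. E \<in> G \<Longrightarrow> E \<subseteq> S" and disj: "disjoint G"
      and dual: "\<And>E. E \<in> G \<Longrightarrow> dual_feasible M E (q E) (\<mu> E)"
    for G and q :: "'i set \<Rightarrow> 'i \<Rightarrow> 'j option \<Rightarrow> real" and \<mu> :: "'i set \<Rightarrow> 'k \<Rightarrow> real"
  proof -
    have feasible: "dual_feasible M S (aggregate_q M G q) (\<lambda>k. \<Sum>E\<in>G. \<mu> E k)"
      using M S G disj dual by (rule dual_feasible_aggregate)
    moreover have "dual_value M S (aggregate_q M G q) (\<lambda>k. \<Sum>E\<in>G. \<mu> E k)
        = (\<Sum>E\<in>G. dual_value M E (q E) (\<mu> E))"
      using finS G disj by (rule dual_value_aggregate)
    ultimately show ?thesis
      using leaf_cost_ge_dual_value[OF M S feasible] by simp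
  qed
  have inheritance: "dual_feasible M S (inherit_q M E q) \<mu> \<and>
      dual_value M S (inherit_q M E q) \<mu> = dual_value M E q \<mu> \<and>
      leaf_cost M S \<ge> ereal (penalty M * real (num_params M) + dual_value M E q \<mu>)"
    if "E \<subseteq> S" and "dual_feasible M E q \<mu>" for E q \<mu>
    using aggregation[of "{E}" "\<lambda>_. q" "\<lambda>_. \<mu>"] that
    by (simp add: aggregate_q_singleton)
  show ?thesis
  proof (rule conjI; intro allI impI; elim conjE)
    fix E q \<mu>
    assume "E \<subseteq> S" "dual_feasible M E q \<mu>"
    then show "dual_feasible M S (inherit_q M E q) \<mu> \<and>
        dual_value M S (inherit_q M E q) \<mu> = dual_value M E q \<mu> \<and>
        leaf_cost M S \<ge> ereal (penalty M * real (num_params M) + dual_value M E q \<mu>)"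
      by (rule inheritance)
  next
    fix G q \<mu>
    assume "\<forall>E\<in>G. E \<subseteq> S" "disjoint G" "\<forall>E\<in>G. dual_feasible M E (q E) (\<mu> E)"
    then show "dual_feasible M S (aggregate_q M G q) (\<lambda>k. \<Sum>E\<in>G. \<mu> E k) \<and>
        dual_value M S (aggregate_q M G q) (\<lambda>k. \<Sum>E\<in>G. \<mu> E k)
          = (\<Sum>E\<in>G. dual_value M E (q E) (\<mu> E)) \<and>
        leaf_cost M S \<ge>
          ereal (penalty M * real (num_params M) + (\<Sum>E\<in>G. dual_value M E (q E) (\<mu> E)))"
      by (intro aggregation[of G q \<mu>]) (simp_all only: Ball_def)
  qed
qed

end
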